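(* Let $(X,d)$ be a complete suprametric space with constant $\rho\ge 0$, i.e., $$d(x,y)\le d(x,z)+d(z,y)+\rho\,d(x,z)\,d(z,y)\quad\text{for all }x,y,z\in X.$$ Let $T:X\to X$ satisfy, for some $m\in\mathbb{N}$ and non-negative constants $a_0,\dots,a_{m-1}$ with $\alpha=\sum_{i=0}^{m-1}a_i<1$, the convex contraction condition of order $m$: $$d(T^mx,T^my)\le\sum_{i=0}^{m-1}a_i\,d(T^ix,T^iy)\quad\text{for all }x,y\in X.$$ Then $T$ possesses a unique fixed point $x^*\in X$. Moreover, for every $x_0\in X$, the Picard iteration $x_n=T^nx_0$ converges to $x^*$ in $(X,d)$, provided at least one of the following conditions holds: (i) $T$ is $k$-continuous for some $k\in\mathbb{N}$, i.e., for any sequence $\{y_n\}\subseteq X$, $T^{k-1}y_n\to z$ implies $T^ky_n\to Tz$; (ii) the displacement function $\mathfrak{D}(x)=d(x,Tx)$ is $T$-orbitally lower semicontinuous at $x_0$, i.e., for any sequence $\{y_n\}\subseteq O(x_0;\infty)$ with $y_n\to z$, we have $\mathfrak{D}(z)\le\liminf_{n\to\infty}\mathfrak{D}(y_n)$; (iii) $T$ satisfies condition $(C)$: if a sequence $\{y_n\}\subseteq O(x_0;\infty)$ satisfies $y_n\to z$ and $\mathfrak{D}(y_n)\to 0$, then $Tz=z$.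
   Context: A suprametric on a nonempty set $X$ is a function $d:X\times X\to[0,\infty)$ such that $d(x,y)=0$ iff $x=y$; $d(x,y)=d(y,x)$; and there is a constant $\rho\in[0,\infty)$ with $d(x,y)\le d(x,z)+d(z,y)+\rho\,d(x,z)\,d(z,y)$ for all $x,y,z\in X$. The pair $(X,d)$ is then called a suprametric space. A sequence $x_n$ converges to $x$ ($x_n\to x$) if $d(x_n,x)\to0$; it is Cauchy if $d(x_n,x_p)\to0$ as $n,p\to\infty$; $(X,d)$ is complete if every Cauchy sequence converges to a point of $X$. $T^j$ denotes the $j$-fold composition of $T$ with itself, $T^0$ is the identity, $\mathbb{N}=\{1,2,3,\dots\}$, $O(x;\infty)=\{x,Tx,T^2x,\dots\}$ is the $T$-orbit of $x$, and $\mathfrak{D}(x)=d(x,Tx)$ for $x\in X$.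
   Formalization: Existence of the fixed point is also made subject to "at least one of (i)-(iii)": without it, existence fails for X={0}∪{4^-j : j≥0}, T0=1, Tx=x/4 otherwise, m=2, a_0=0, a_1=1/2. *)

theory Defs
  imports Complex_Main "HOL-Library.Extended_Real"
begin

definition suprametric_on :: "'a set \<Rightarrow> ('a \<Rightarrow> 'a \<Rightarrow> real) \<Rightarrow> real \<Rightarrow> bool" where
  "suprametric_on X d \<rho> \<longleftrightarrow>
     X \<noteq> {} \<and> 0 \<le> \<rho> \<and>
     (\<forall>x\<in>X. \<forall>y\<in>X. 0 \<le> d x y) \<and>
     (\<forall>x\<in>X. \<forall>y\<in>X. d x y = 0 \<longleftrightarrow> x = y) \<and>
     (\<forall>x\<in>X. \<forall>y\<in>X. d x y = d y x) \<and>
     (\<forall>x\<in>X. \<forall>y\<in>X. \<forall>z\<in>X. d x y \<le> d x z + d z y + \<rho> * d x z * d z y)"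

definition supra_converges :: "('a \<Rightarrow> 'a \<Rightarrow> real) \<Rightarrow> (nat \<Rightarrow> 'a) \<Rightarrow> 'a \<Rightarrow> bool" where
  "supra_converges d s z \<longleftrightarrow> (\<lambda>n. d (s n) z) \<longlonglongrightarrow> 0"

definition supra_Cauchy :: "('a \<Rightarrow> 'a \<Rightarrow> real) \<Rightarrow> (nat \<Rightarrow> 'a) \<Rightarrow> bool" where
  "supra_Cauchy d s \<longleftrightarrow>
     ((\<lambda>(n, p). d (s n) (s p)) \<longlongrightarrow> 0) (sequentially \<times>\<^sub>F sequentially)"

definition supra_complete_on :: "'a set \<Rightarrow> ('a \<Rightarrow> 'a \<Rightarrow> real) \<Rightarrow> bool" where
  "supra_complete_on X d \<longleftrightarrow>
     (\<forall>s. range s \<subseteq> X \<and> supra_Cauchy d s \<longrightarrow> (\<exists>z\<in>X. supra_converges d s z))"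

definition convex_contraction_on ::
  "'a set \<Rightarrow> ('a \<Rightarrow> 'a \<Rightarrow> real) \<Rightarrow> ('a \<Rightarrow> 'a) \<Rightarrow> nat \<Rightarrow> (nat \<Rightarrow> real) \<Rightarrow> bool" where
  "convex_contraction_on X d T m a \<longleftrightarrow>
     (\<forall>i<m. 0 \<le> a i) \<and> (\<Sum>i<m. a i) < 1 \<and>
     (\<forall>x\<in>X. \<forall>y\<in>X. d ((T ^^ m) x) ((T ^^ m) y) \<le> (\<Sum>i<m. a i * d ((T ^^ i) x) ((T ^^ i) y)))"

text \<open>Used only for \<open>k \<ge> 1\<close>; for \<open>k = 0\<close> the truncated \<open>k - 1\<close> would be meaningless.\<close>

definition k_continuous_on ::
  "'a set \<Rightarrow> ('a \<Rightarrow> 'a \<Rightarrow> real) \<Rightarrow> ('a \<Rightarrow> 'a) \<Rightarrow> nat \<Rightarrow> bool" where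
  "k_continuous_on X d T k \<longleftrightarrow>
     (\<forall>y z. range y \<subseteq> X \<and> z \<in> X \<and> supra_converges d (\<lambda>n. (T ^^ (k - 1)) (y n)) z
        \<longrightarrow> supra_converges d (\<lambda>n. (T ^^ k) (y n)) (T z))"

definition orbit_of :: "('a \<Rightarrow> 'a) \<Rightarrow> 'a \<Rightarrow> 'a set" where
  "orbit_of T x = range (\<lambda>n. (T ^^ n) x)"

definition displacement :: "('a \<Rightarrow> 'a \<Rightarrow> real) \<Rightarrow> ('a \<Rightarrow> 'a) \<Rightarrow> 'a \<Rightarrow> real" where
  "displacement d T x = d x (T x)"

text \<open>The \<open>liminf\<close> is taken in the extended reals, as displacements along a sequence
  may be unbounded.\<close>

definition displacement_orbitally_lsc ::
  "'a set \<Rightarrow> ('a \<Rightarrow> 'a \<Rightarrow> real) \<Rightarrow> ('a \<Rightarrow> 'a) \<Rightarrow> 'a \<Rightarrow> bool" where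
  "displacement_orbitally_lsc X d T x0 \<longleftrightarrow>
     (\<forall>y z. range y \<subseteq> orbit_of T x0 \<and> z \<in> X \<and> supra_converges d y z
        \<longrightarrow> ereal (displacement d T z) \<le> liminf (\<lambda>n. ereal (displacement d T (y n))))"

definition condition_C ::
  "'a set \<Rightarrow> ('a \<Rightarrow> 'a \<Rightarrow> real) \<Rightarrow> ('a \<Rightarrow> 'a) \<Rightarrow> 'a \<Rightarrow> bool" where
  "condition_C X d T x0 \<longleftrightarrow>
     (\<forall>y z. range y \<subseteq> orbit_of T x0 \<and> z \<in> X \<and> supra_converges d y z
            \<and> (\<lambda>n. displacement d T (y n)) \<longlonglongrightarrow> 0
        \<longrightarrow> T z = z)"

end

theory Submission imports Defs begin

text \<open>
  The distance between the orbits of two points obeys a linear recursive inequality: with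
  \<open>u n = d (T\<^sup>n x) (T\<^sup>n y)\<close>, the contraction condition at \<open>T\<^sup>n x\<close> and \<open>T\<^sup>n y\<close> reads
  \<open>u (n + m) \<le> (\<Sum>i<m. a i * u (n + i))\<close>.  Since the coefficients sum to less than 1, such a
  sequence decays geometrically (\<open>geometric_bound_of_recursive_inequality\<close>).  Hence any two
  orbits approach each other, and this is what makes the fixed point unique and lets every
  Picard iteration converge to it as soon as one fixed point exists.

  With \<open>y = T x\<close> the same decay makes the consecutive distances along an orbit summable.  In a
  suprametric space, as in a metric space, that is enough for the orbit to be Cauchy: the extra
  factor \<open>1 + \<rho> * u\<close> that each application of the weakened triangle inequality costs is at most
  \<open>exp (\<rho> * u)\<close>, and the product of these factors is controlled by the same convergent sum
  (\<open>suprametric_chain_bound\<close>).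

  So the orbit of \<open>x0\<close> has a limit \<open>z\<close>, along which the displacement tends to 0.
  Condition (C) says precisely that \<open>z\<close> is then fixed; orbital lower
  semicontinuity of the displacement implies condition (C); and under \<open>k\<close>-continuity the shifted
  orbit converges both to \<open>z\<close> and to \<open>T z\<close>.
\<close>

section \<open>Linear recursive inequalities\<close>

text \<open>
  The rate \<open>q\<close> is chosen so that the coefficient sum is at most \<open>q ^ m\<close>.  A bound \<open>C * q ^ n\<close> then
  propagates through the recursion because \<open>q ^ (n + i) \<le> q ^ n\<close>, so that \<open>m\<close> steps gain the full
  factor \<open>q ^ m\<close>.
\<close>

lemma geometric_bound_of_recursive_inequality:
  fixes u a :: "nat \<Rightarrow> real"
  assumes m: "m \<ge> 1"
    and a: "\<And>i. i < m \<Longrightarrow> 0 \<le> a i" "(\<Sum>i<m. a i) < 1"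
    and u: "\<And>n. 0 \<le> u n" "\<And>n. u (n + m) \<le> (\<Sum>i<m. a i * u (n + i))"
  obtains C q where "0 \<le> C" "0 < q" "q < 1" "\<And>n. u n \<le> C * q ^ n"
proof -
  define \<alpha> where "\<alpha> = (\<Sum>i<m. a i)"
  \<comment> \<open>The root of \<open>\<alpha>\<close> itself would vanish for \<open>\<alpha> = 0\<close>, but the initial values are divided by
      powers of \<open>q\<close>; so \<open>q\<close> is the root of a number strictly between \<open>\<alpha>\<close> and 1.\<close>
  define q where "q = root m ((1 + \<alpha>) / 2)"
  have \<alpha>: "0 \<le> \<alpha>" "\<alpha> < 1"
    using a by (auto simp: \<alpha>_def intro: sum_nonneg)
  have q: "0 < q" "q < 1"
    using \<alpha> m by (auto simp: q_def)
  have qm: "\<alpha> \<le> q ^ m"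
    using \<alpha> m by (simp add: q_def)
  define C where "C = (\<Sum>n<m. u n / q ^ n)"
  have C: "0 \<le> C"
    using u(1) q by (auto simp: C_def intro!: sum_nonneg)
  have "u n \<le> C * q ^ n" for n
  proof (induction n rule: less_induct)
    case (less n)
    show ?case
    proof (cases "n < m")
      case True
      have "u n / q ^ n \<le> C"
        unfolding C_def using True u(1) q by (intro member_le_sum) auto
      then show ?thesis
        using q by (simp add: field_simps)
    next
      case False
      then obtain k where n: "n = k + m"
        by (metis add.commute le_Suc_ex not_less)
      have "u (k + i) \<le> C * q ^ k" if "i < m" for i
      proof -
        have "u (k + i) \<le> C * q ^ (k + i)"
          using that n by (intro less) simp
        also have "\<dots> \<le> C * q ^ k"
          using q C by (intro mult_left_mono power_decreasing) auto
        finally show ?thesis .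
      qed
      then have "(\<Sum>i<m. a i * u (k + i)) \<le> (\<Sum>i<m. a i * (C * q ^ k))"
        using a(1) by (intro sum_mono mult_left_mono) auto
      also have "\<dots> = \<alpha> * (C * q ^ k)"
        by (simp add: \<alpha>_def sum_distrib_right)
      also have "\<dots> \<le> q ^ m * (C * q ^ k)"
        using qm C q by (intro mult_right_mono) auto
      finally show ?thesis
        using u(2)[of k] n by (simp add: power_add mult_ac)
    qed
  qed
  with C q show ?thesis
    by (intro that)
qed

corollary summable_of_recursive_inequality:
  fixes u a :: "nat \<Rightarrow> real"
  assumes "m \<ge> 1"
    and "\<And>i. i < m \<Longrightarrow> 0 \<le> a i" "(\<Sum>i<m. a i) < 1"
    and "\<And>n. 0 \<le> u n" "\<And>n. u (n + m) \<le> (\<Sum>i<m. a i * u (n + i))"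
  shows "summable u"
proof -
  obtain C q where q: "0 < q" "q < 1" and le: "\<And>n. u n \<le> C * q ^ n"
    using assms geometric_bound_of_recursive_inequality[of m a u] by metis
  have "summable (\<lambda>n. C * q ^ n)"
    using q by (intro summable_mult summable_geometric) auto
  then show ?thesis
    by (rule summable_comparison_test') (use le assms(4) in auto)
qed

section \<open>Convergence in suprametric spaces\<close>

lemma suprametric_onD:
  assumes "suprametric_on X d \<rho>"
  shows "0 \<le> \<rho>"
    and "\<lbrakk>x \<in> X; y \<in> X\<rbrakk> \<Longrightarrow> 0 \<le> d x y"
    and "\<lbrakk>x \<in> X; y \<in> X\<rbrakk> \<Longrightarrow> d x y = 0 \<longleftrightarrow> x = y"
    and "\<lbrakk>x \<in> X; y \<in> X\<rbrakk> \<Longrightarrow> d x y = d y x"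
    and "\<lbrakk>x \<in> X; y \<in> X; z \<in> X\<rbrakk> \<Longrightarrow> d x y \<le> d x z + d z y + \<rho> * d x z * d z y"
  using assms unfolding suprametric_on_def by blast+

lemma supra_limit_unique:
  assumes d: "suprametric_on X d \<rho>"
    and X: "range s \<subseteq> X" "z \<in> X" "w \<in> X"
    and lim: "supra_converges d s z" "supra_converges d s w"
  shows "z = w"
proof -
  note sm = suprametric_onD[OF d]
  have z: "(\<lambda>n. d (s n) z) \<longlonglongrightarrow> 0" and w: "(\<lambda>n. d (s n) w) \<longlonglongrightarrow> 0"
    using lim by (auto simp: supra_converges_def)
  have "(\<lambda>n. d (s n) z + d (s n) w + \<rho> * d (s n) z * d (s n) w) \<longlonglongrightarrow> 0 + 0 + \<rho> * 0 * 0"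
    by (intro tendsto_intros z w)
  moreover have "d z w \<le> d (s n) z + d (s n) w + \<rho> * d (s n) z * d (s n) w" for n
  proof -
    have sn: "s n \<in> X"
      using X by auto
    show ?thesis
      using sm(5)[OF X(2,3) sn] sm(4)[OF X(2) sn] by simp
  qed
  ultimately have "d z w \<le> 0"
    by (intro LIMSEQ_le_const) auto
  then have "d z w = 0"
    using sm(2)[OF X(2,3)] by simp
  then show ?thesis
    using sm(3)[OF X(2,3)] by simp
qed

text \<open>
  Appending a step of length \<open>u\<close> to a chain turns the distance \<open>D\<close> into at most
  \<open>D * (1 + \<rho> * u) + u\<close>.  Replacing the factor by \<open>exp (\<rho> * u)\<close> yields a bound
  that depends on the steps only through their sum.
\<close>

lemma suprametric_chain_bound:
  assumes d: "suprametric_on X d \<rho>" and s: "range s \<subseteq> X"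
  shows "d (s n) (s (n + p)) \<le>
           (\<Sum>j<p. d (s (n + j)) (s (n + Suc j))) *
           exp (\<rho> * (\<Sum>j<p. d (s (n + j)) (s (n + Suc j))))"
proof (induction p)
  case 0
  have "d (s n) (s n) = 0"
    using suprametric_onD(3)[OF d] s by blast
  then show ?case
    by simp
next
  case (Suc p)
  note sm = suprametric_onD[OF d]
  have sX: "s k \<in> X" for k
    using s by auto
  define u where "u = d (s (n + p)) (s (n + Suc p))"
  define S where "S = (\<Sum>j<p. d (s (n + j)) (s (n + Suc j)))"
  have u: "0 \<le> u" and S: "0 \<le> S"
    using sm(2) sX by (auto simp: u_def S_def intro!: sum_nonneg)
  have "d (s n) (s (n + Suc p)) \<le> d (s n) (s (n + p)) * (1 + \<rho> * u) + u"
    using sm(5)[OF sX[of n] sX[of "n + Suc p"] sX[of "n + p"]]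
    by (simp add: u_def algebra_simps)
  also have "\<dots> \<le> S * exp (\<rho> * S) * exp (\<rho> * u) + u * exp (\<rho> * (S + u))"
  proof (rule add_mono)
    show "d (s n) (s (n + p)) * (1 + \<rho> * u) \<le> S * exp (\<rho> * S) * exp (\<rho> * u)"
      using Suc S u sm(1) sm(2)[OF sX sX]
      by (intro mult_mono) (auto simp: S_def exp_ge_add_one_self)
    have "1 \<le> exp (\<rho> * (S + u))"
      using S u sm(1) by simp
    then show "u \<le> u * exp (\<rho> * (S + u))"
      using u mult_left_mono by fastforce
  qed
  also have "\<dots> = (S + u) * exp (\<rho> * (S + u))"
    by (simp add: algebra_simps exp_add)
  finally show ?case
    by (simp add: S_def u_def)
qed

lemma supra_Cauchy_of_summable_steps:
  assumes d: "suprametric_on X d \<rho>" and s: "range s \<subseteq> X"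
    and sum: "summable (\<lambda>n. d (s n) (s (Suc n)))"
  shows "supra_Cauchy d s"
proof -
  note sm = suprametric_onD[OF d]
  have sX: "s k \<in> X" for k
    using s by auto
  define t where "t n = (\<Sum>j. d (s (j + n)) (s (Suc (j + n))))" for n
  define b where "b n = t n * exp (\<rho> * t n)" for n
  have t: "t \<longlonglongrightarrow> 0"
  proof -
    have "t n = (\<Sum>j. d (s j) (s (Suc j))) - (\<Sum>j<n. d (s j) (s (Suc j)))" for n
      unfolding t_def by (rule suminf_minus_initial_segment[OF sum])
    then have "t = (\<lambda>n. (\<Sum>j. d (s j) (s (Suc j))) - (\<Sum>j<n. d (s j) (s (Suc j))))"
      by (rule ext)
    moreover have "\<dots> \<longlonglongrightarrow> (\<Sum>j. d (s j) (s (Suc j))) - (\<Sum>j. d (s j) (s (Suc j)))"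
      by (intro tendsto_diff tendsto_const summable_LIMSEQ sum)
    ultimately show ?thesis
      by simp
  qed
  have "b \<longlonglongrightarrow> 0 * exp (\<rho> * 0)"
    unfolding b_def by (intro tendsto_intros t)
  then have b: "b \<longlonglongrightarrow> 0"
    by simp
  have le: "d (s n) (s (n + p)) \<le> b n" for n p
  proof -
    define S where "S = (\<Sum>j<p. d (s (n + j)) (s (n + Suc j)))"
    have "S \<le> t n"
      unfolding S_def t_def
      using sum_le_suminf[of "\<lambda>j. d (s (j + n)) (s (Suc (j + n)))" "{..<p}"]
        summable_iff_shift[of "\<lambda>n. d (s n) (s (Suc n))" n] sum sm(2) sX
      by (simp add: add.commute)
    moreover have "0 \<le> S"
      using sm(2) sX by (auto simp: S_def intro!: sum_nonneg)
    ultimately have "S * exp (\<rho> * S) \<le> b n"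
      unfolding b_def using sm(1) by (intro mult_mono) (auto intro: mult_left_mono)
    then show ?thesis
      using suprametric_chain_bound[OF d s, of n p] by (simp add: S_def)
  qed
  have bound: "d (s n) (s p) \<le> b (min n p)" for n p
    by (cases "n \<le> p") (use le[of n "p - n"] le[of p "n - p"] sm(4) sX in \<open>auto simp: min_def\<close>)
  show ?thesis
    unfolding supra_Cauchy_def
  proof (rule tendstoI)
    fix e :: real
    assume "0 < e"
    then obtain N where N: "\<And>n. n \<ge> N \<Longrightarrow> \<bar>b n\<bar> < e"
      using b LIMSEQ_D by fastforce
    have "d (s n) (s p) < e" if "n \<ge> N" "p \<ge> N" for n p
      using bound[of n p] N[of "min n p"] that by fastforce
    then have "\<forall>n\<ge>N. \<forall>p\<ge>N. dist (d (s n) (s p)) 0 < e"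
      using sm(2) sX by simp
    then have "\<forall>\<^sub>F x in sequentially \<times>\<^sub>F sequentially.
        dist (d (s (fst x)) (s (snd x))) 0 < e"
      using eventually_ge_at_top[of N] by (auto simp: eventually_prod_sequentially)
    then show "\<forall>\<^sub>F x in sequentially \<times>\<^sub>F sequentially.
        dist (case x of (n, p) \<Rightarrow> d (s n) (s p)) 0 < e"
      by (simp add: case_prod_beta)
  qed
qed

section \<open>Orbits of convex contractions\<close>

lemma funpow_mem:
  assumes "T ` X \<subseteq> X" "x \<in> X"
  shows "(T ^^ n) x \<in> X"
  using assms by (induction n) auto

text \<open>
  This one fact serves twice: for \<open>y = T x\<close> it makes an orbit Cauchy, and for a fixed point \<open>y\<close>
  it makes the orbit of \<open>x\<close> converge to \<open>y\<close>.
\<close>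

lemma convex_contraction_orbits_summable:
  assumes d: "suprametric_on X d \<rho>" and T: "T ` X \<subseteq> X"
    and m: "m \<ge> 1" and cc: "convex_contraction_on X d T m a"
    and X: "x \<in> X" "y \<in> X"
  shows "summable (\<lambda>n. d ((T ^^ n) x) ((T ^^ n) y))"
proof (rule summable_of_recursive_inequality[where m = m and a = a])
  show "d ((T ^^ (n + m)) x) ((T ^^ (n + m)) y)
      \<le> (\<Sum>i<m. a i * d ((T ^^ (n + i)) x) ((T ^^ (n + i)) y))" for n
  proof -
    have "d ((T ^^ m) ((T ^^ n) x)) ((T ^^ m) ((T ^^ n) y))
        \<le> (\<Sum>i<m. a i * d ((T ^^ i) ((T ^^ n) x)) ((T ^^ i) ((T ^^ n) y)))"
      using cc funpow_mem[OF T] X by (auto simp: convex_contraction_on_def)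
    then show ?thesis
      by (subst (1 2 3 4) add.commute) (simp add: funpow_add)
  qed
qed (use m cc suprametric_onD(2)[OF d] funpow_mem[OF T] X in \<open>auto simp: convex_contraction_on_def\<close>)

lemma convex_contraction_displacement_summable:
  assumes "suprametric_on X d \<rho>" "T ` X \<subseteq> X" "m \<ge> 1"
    and "convex_contraction_on X d T m a" "x \<in> X"
  shows "summable (\<lambda>n. displacement d T ((T ^^ n) x))"
  using convex_contraction_orbits_summable[OF assms, of "T x"] assms
  by (auto simp: displacement_def funpow_swap1)

lemma convex_contraction_orbit_converges:
  assumes "suprametric_on X d \<rho>" "supra_complete_on X d" "T ` X \<subseteq> X" "m \<ge> 1"
    and "convex_contraction_on X d T m a" "x \<in> X"
  obtains z where "z \<in> X" "supra_converges d (\<lambda>n. (T ^^ n) x) z"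
proof -
  have ran: "range (\<lambda>n. (T ^^ n) x) \<subseteq> X"
    using funpow_mem[of T X] assms by auto
  have "supra_Cauchy d (\<lambda>n. (T ^^ n) x)"
    using supra_Cauchy_of_summable_steps[OF assms(1) ran]
      convex_contraction_displacement_summable[OF assms(1,3-6)]
    by (simp add: displacement_def)
  then show ?thesis
    using assms(2) ran that by (auto simp: supra_complete_on_def)
qed

lemma convex_contraction_converges_to_fixed_point:
  assumes "suprametric_on X d \<rho>" "T ` X \<subseteq> X" "m \<ge> 1"
    and "convex_contraction_on X d T m a" "x \<in> X" "z \<in> X" "T z = z"
  shows "supra_converges d (\<lambda>n. (T ^^ n) x) z"
proof -
  have "(T ^^ n) z = z" for n
    by (induction n) (use assms(7) in auto)
  then show ?thesis
    using summable_LIMSEQ_zero[OF convex_contraction_orbits_summable[OF assms(1-6)]]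
    by (simp add: supra_converges_def)
qed

section \<open>Fixedness of the limit of an orbit\<close>

text \<open>
  If the displacements along the sequence tend to 0, then 0 is their lower limit, and
  semicontinuity leaves no room for a positive displacement at the limit point.
\<close>

lemma displacement_lsc_imp_condition_C:
  assumes d: "suprametric_on X d \<rho>" and T: "T ` X \<subseteq> X"
    and lsc: "displacement_orbitally_lsc X d T x"
  shows "condition_C X d T x"
  unfolding condition_C_def
proof (intro allI impI, elim conjE)
  fix y z
  assume y: "range y \<subseteq> orbit_of T x" and z: "z \<in> X" and lim: "supra_converges d y z"
    and D: "(\<lambda>n. displacement d T (y n)) \<longlonglongrightarrow> 0"
  have "(\<lambda>n. ereal (displacement d T (y n))) \<longlonglongrightarrow> ereal 0"
    using D by simp
  then have "liminf (\<lambda>n. ereal (displacement d T (y n))) = ereal 0"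
    by (intro lim_imp_Liminf) auto
  then have "displacement d T z \<le> 0"
    using lsc y z lim unfolding displacement_orbitally_lsc_def
    by (metis ereal_less_eq(3))
  moreover have "T z \<in> X"
    using T z by auto
  ultimately show "T z = z"
    using suprametric_onD(2,3)[OF d z] by (force simp: displacement_def)
qed

text \<open>
  Both \<open>T\<^sup>k\<^sup>-\<^sup>1\<close> and \<open>T\<^sup>k\<close> merely shift an orbit, so neither changes its limit; \<open>k\<close>-continuity
  applied to the orbit itself therefore equates \<open>z\<close> with \<open>T z\<close>.
\<close>

lemma k_continuous_fixes_orbit_limit:
  assumes d: "suprametric_on X d \<rho>" and T: "T ` X \<subseteq> X"
    and k: "k \<ge> 1" "k_continuous_on X d T k"
    and X: "x \<in> X" "z \<in> X" and lim: "supra_converges d (\<lambda>n. (T ^^ n) x) z"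
  shows "T z = z"
proof -
  have ran: "range (\<lambda>n. (T ^^ n) x) \<subseteq> X"
    using funpow_mem[OF T] X by auto
  have shift: "supra_converges d (\<lambda>n. (T ^^ j) ((T ^^ n) x)) z" for j
    using LIMSEQ_ignore_initial_segment[OF lim[unfolded supra_converges_def], of j]
    by (subst (asm) add.commute) (simp add: supra_converges_def funpow_add)
  have "supra_converges d (\<lambda>n. (T ^^ k) ((T ^^ n) x)) (T z)"
    using k(2) ran X(2) shift by (auto simp: k_continuous_on_def)
  moreover have "range (\<lambda>n. (T ^^ k) ((T ^^ n) x)) \<subseteq> X"
    using funpow_mem[OF T] X by auto
  ultimately show ?thesis
    using supra_limit_unique[OF d _ _ X(2)] shift T X(2) by blast
qed

section \<open>The fixed point theorem\<close>

theorem theorem2p1: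
  fixes X :: "'a set" and d :: "'a \<Rightarrow> 'a \<Rightarrow> real" and \<rho> :: real
    and T :: "'a \<Rightarrow> 'a" and m :: nat and a :: "nat \<Rightarrow> real" and x0 :: 'a
  assumes "suprametric_on X d \<rho>"
    and "supra_complete_on X d"
    and "T ` X \<subseteq> X"
    and "m \<ge> 1"
    and "convex_contraction_on X d T m a"
    and "x0 \<in> X"
    and "(\<exists>k\<ge>1. k_continuous_on X d T k)
         \<or> displacement_orbitally_lsc X d T x0
         \<or> condition_C X d T x0"
  shows "\<exists>xstar\<in>X. T xstar = xstar \<and> (\<forall>y\<in>X. T y = y \<longrightarrow> y = xstar)
           \<and> (\<forall>x\<in>X. supra_converges d (\<lambda>n. (T ^^ n) x) xstar)"
proof -
  note d = assms(1) and T = assms(3)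
  obtain z where z: "z \<in> X" and lim: "supra_converges d (\<lambda>n. (T ^^ n) x0) z"
    using convex_contraction_orbit_converges[OF assms(1-6)] .
  have "T z = z"
  proof -
    have "T z = z" if "condition_C X d T x0"
    proof -
      have "(\<lambda>n. displacement d T ((T ^^ n) x0)) \<longlonglongrightarrow> 0"
        by (intro summable_LIMSEQ_zero
            convex_contraction_displacement_summable[OF d T assms(4,5,6)])
      moreover have "range (\<lambda>n. (T ^^ n) x0) \<subseteq> orbit_of T x0"
        by (simp add: orbit_of_def)
      ultimately show ?thesis
        using that z lim unfolding condition_C_def by blast
    qed
    then show ?thesis
      using assms(7) displacement_lsc_imp_condition_C[OF d T]
        k_continuous_fixes_orbit_limit[OF d T _ _ assms(6) z lim] by blast
  qed
  then have conv: "supra_converges d (\<lambda>n. (T ^^ n) x) z" if "x \<in> X" for x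
    using convex_contraction_converges_to_fixed_point[OF d T assms(4,5) that z] by simp
  have "y = z" if y: "y \<in> X" "T y = y" for y
  proof (rule supra_limit_unique[OF d _ y(1) z])
    \<comment> \<open>The orbit of the fixed point \<open>y\<close> is constant, yet it converges to \<open>z\<close> as well.\<close>
    show "supra_converges d (\<lambda>n. (T ^^ n) y) y"
      using convex_contraction_converges_to_fixed_point[OF d T assms(4,5) y(1,1,2)] .
    show "supra_converges d (\<lambda>n. (T ^^ n) y) z"
      using conv[OF y(1)] .
    show "range (\<lambda>n. (T ^^ n) y) \<subseteq> X"
      using funpow_mem[OF T y(1)] by auto
  qed
  then show ?thesis
    using z \<open>T z = z\<close> conv by blast
qed

end
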